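(* Let $(X,\mathcal{K})$ be any one of the three pairs $(\widetilde{S}^m,K_S(\mathbb{R}^m))$, $(S^m,K_S(\mathbb{R}^m))$, $(E^m,K_C(\mathbb{R}^m))$, and let $U$ be a subset of $X$. Then $U$ is a relatively compact set in $(X,H_{\rm end})$ if and only if (i) for each $\alpha\in(0,1]$, $U_\alpha:=\{[u]_\alpha:u\in U\}$ is a bounded set in $(\mathcal{K},H)$, and (ii$'$) given any sequence $\{u_n:n=1,2,\ldots\}\subset U$, there exist an $r>0$ and a subsequence $\{v_n\}$ of $\{u_n\}$ such that $\lim_{n\to\infty}|v_n|_r=0$.
   Context: A fuzzy set on $\mathbb{R}^m$ is a function $u:\mathbb{R}^m\to[0,1]$. For $\alpha\in(0,1]$, $[u]_\alpha=\{x:u(x)\ge\alpha\}$, and $[u]_0=\overline{\{x:u(x)>0\}}$. Each of the following consists of upper semi-continuous fuzzy sets $u$ on $\mathbb{R}^m$ that are normal ($u(x_0)=1$ for some $x_0$), have $[u]_0$ bounded, and in addition: - $E^m$: $u(\lambda x+(1-\lambda)y)\ge\min\{u(x),u(y)\}$ for all $x,y\in\mathbb{R}^m$, $\lambda\in[0,1]$; - $S^m$: there exists $x\in\mathbb{R}^m$ such that $u(\lambda y+(1-\lambda)x)\ge u(y)$ for all $y\in\mathbb{R}^m$, $\lambda\in[0,1]$; - $\widetilde{S}^m$: for each $\lambda\in(0,1]$ there is $x_\lambda\in[u]_\lambda$ such that the line segment $\overline{x_\lambda y}$ is contained in $[u]_\lambda$ for all $y\in[u]_\lambda$. $K_C(\mathbb{R}^m)$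 and $K_S(\mathbb{R}^m)$ are the sets of all nonempty compact convex, and nonempty compact star-shaped, subsets of $\mathbb{R}^m$ respectively ($K$ is star-shaped if there is $x\in K$ with $\overline{xy}\subset K$ for every $y\in K$). $H(A,B)=\max\{\sup_{a\in A}\inf_{b\in B}d(a,b),\ \sup_{b\in B}\inf_{a\in A}d(a,b)\}$ is the Hausdorff metric on nonempty closed sets ($d$ Euclidean). The endograph of $u$ is ${\rm end}\,u=\{(x,t)\in\mathbb{R}^m\times[0,1]:u(x)\ge t\}$ and $H_{\rm end}(u,v)=H({\rm end}\,u,{\rm end}\,v)$ for upper semi-continuous fuzzy sets $u,v$. For $r>0$, $B_r=\{x\in\mathbb{R}^m:\|x\|\le r\}$, $\widehat{B_r}$ is its characteristic function, and $|u|_r:=H_{\rm end}(u\vee\widehat{B_r},\widehat{B_r})$, where $\vee$ is the pointwise maximum. A set is relatively compact in a metric space if its closure in that space is compact. *)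

theory Defs
  imports "HOL-Analysis.Analysis"
begin

section \<open>The Hausdorff metric\<close>

text \<open>
  The suprema are taken in the extended nonnegative reals and the result is mapped back to the
  reals, with value 0 when the distance is infinite.  This case does not occur on the families
  considered below (compact sets, and endographs).  The convention makes the function nonnegative
  and symmetric on all arguments, as the locale \<^locale>\<open>Metric_space\<close> demands.
\<close>

definition hausdorff_dist :: "'a::metric_space set \<Rightarrow> 'a set \<Rightarrow> real" where
  "hausdorff_dist A B =
     enn2real (max (SUP a\<in>A. ennreal (infdist a B)) (SUP b\<in>B. ennreal (infdist b A)))"

lemma hausdorff_dist_le_iff:
  assumes "\<And>a. a \<in> A \<Longrightarrow> infdist a B \<le> s" "\<And>b. b \<in> B \<Longrightarrow> infdist b A \<le> s" "0 \<le> r"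
  shows "hausdorff_dist A B \<le> r \<longleftrightarrow> (\<forall>a\<in>A. infdist a B \<le> r) \<and> (\<forall>b\<in>B. infdist b A \<le> r)"
proof -
  let ?m = "max (SUP a\<in>A. ennreal (infdist a B)) (SUP b\<in>B. ennreal (infdist b A))"
  have "?m \<le> ennreal s"
    using assms(1,2) by (auto intro!: SUP_least ennreal_leI)
  then have "?m \<noteq> top"
    using neq_top_trans[OF ennreal_neq_top] by blast
  then have m: "?m = ennreal (enn2real ?m)"
    by (simp only: ennreal_enn2real_if if_False)
  have "hausdorff_dist A B \<le> r \<longleftrightarrow> ?m \<le> ennreal r"
    unfolding hausdorff_dist_def by (subst (2) m) (simp only: ennreal_le_iff[OF assms(3)])
  also have "\<dots> \<longleftrightarrow> (\<forall>a\<in>A. infdist a B \<le> r) \<and> (\<forall>b\<in>B. infdist b A \<le> r)"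
    by (simp add: SUP_le_iff ennreal_le_iff[OF assms(3)])
  finally show ?thesis .
qed

lemma Metric_space_hausdorff_dist:
  assumes ne: "\<And>A. A \<in> M \<Longrightarrow> A \<noteq> {}" and cl: "\<And>A. A \<in> M \<Longrightarrow> closed A"
    and bd: "\<And>A B. \<lbrakk>A \<in> M; B \<in> M\<rbrakk> \<Longrightarrow> \<exists>s. \<forall>a\<in>A. infdist a B \<le> s"
  shows "Metric_space M hausdorff_dist"
proof -
  have nonneg: "0 \<le> hausdorff_dist A B" for A B :: "'a set"
    by (simp add: hausdorff_dist_def)
  have commute: "hausdorff_dist A B = hausdorff_dist B A" for A B :: "'a set"
    by (simp add: hausdorff_dist_def max.commute)
  have iff: "hausdorff_dist A B \<le> r \<longleftrightarrow>
      (\<forall>a\<in>A. infdist a B \<le> r) \<and> (\<forall>b\<in>B. infdist b A \<le> r)"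
    if "A \<in> M" "B \<in> M" "0 \<le> r" for A B r
  proof -
    from bd[OF that(1,2)] bd[OF that(2,1)] obtain s t
      where "\<forall>a\<in>A. infdist a B \<le> s" "\<forall>b\<in>B. infdist b A \<le> t" by blast
    then show ?thesis
      using that(3) by (intro hausdorff_dist_le_iff[where s = "max s t"]) auto
  qed
  have tri: "infdist a C \<le> hausdorff_dist A B + hausdorff_dist B C"
    if "A \<in> M" "B \<in> M" "C \<in> M" "a \<in> A" for A B C a
  proof -
    have "infdist a C - hausdorff_dist B C \<le> dist a b" if "b \<in> B" for b
    proof -
      have "infdist b C \<le> hausdorff_dist B C"
        using iff[OF \<open>B \<in> M\<close> \<open>C \<in> M\<close> nonneg] that by blast
      then show ?thesis
        using infdist_triangle[of a C b] by linarith
    qed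
    then have "infdist a C - hausdorff_dist B C \<le> infdist a B"
      using ne[OF \<open>B \<in> M\<close>] by (auto simp: infdist_notempty intro!: cINF_greatest)
    moreover have "infdist a B \<le> hausdorff_dist A B"
      using iff[OF \<open>A \<in> M\<close> \<open>B \<in> M\<close> nonneg] that by blast
    ultimately show ?thesis by linarith
  qed
  show ?thesis
  proof
    show "hausdorff_dist A B = 0 \<longleftrightarrow> A = B" if "A \<in> M" "B \<in> M" for A B
    proof -
      have "hausdorff_dist A B = 0 \<longleftrightarrow> hausdorff_dist A B \<le> 0"
        using nonneg[of A B] by linarith
      also have "\<dots> \<longleftrightarrow> (\<forall>a\<in>A. infdist a B = 0) \<and> (\<forall>b\<in>B. infdist b A = 0)"
        using iff[OF that, of 0] by (metis infdist_nonneg order.antisym order.refl)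
      also have "\<dots> \<longleftrightarrow> A = B"
        using in_closed_iff_infdist_zero[OF cl ne] that by blast
      finally show ?thesis .
    qed
    show "hausdorff_dist A C \<le> hausdorff_dist A B + hausdorff_dist B C"
      if "A \<in> M" "B \<in> M" "C \<in> M" for A B C
      using tri[of A B C] tri[of C B A] that nonneg[of A B] nonneg[of B C]
      by (subst iff) (auto simp: commute add.commute)
  qed (use nonneg commute in auto)
qed

definition compact_convex_sets :: "'a::euclidean_space set set" where
  "compact_convex_sets = {K. K \<noteq> {} \<and> compact K \<and> convex K}"

definition compact_starlike_sets :: "'a::euclidean_space set set" where
  "compact_starlike_sets = {K. K \<noteq> {} \<and> compact K \<and> starlike K}"

lemma Metric_space_compact_sets:
  "Metric_space {K :: 'a::euclidean_space set. K \<noteq> {} \<and> compact K} hausdorff_dist"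
proof (rule Metric_space_hausdorff_dist)
  fix A B :: "'a set"
  assume A: "A \<in> {K. K \<noteq> {} \<and> compact K}"
  then have "compact ((\<lambda>a. infdist a B) ` A)"
    by (intro compact_continuous_image continuous_on_infdist continuous_on_id) simp
  then have "bdd_above ((\<lambda>a. infdist a B) ` A)"
    by (intro bounded_imp_bdd_above compact_imp_bounded)
  then show "\<exists>s. \<forall>a\<in>A. infdist a B \<le> s"
    unfolding bdd_above_def by auto
qed (auto intro: compact_imp_closed)

lemma Metric_space_compact_convex_sets: "Metric_space compact_convex_sets hausdorff_dist"
  and Metric_space_compact_starlike_sets: "Metric_space compact_starlike_sets hausdorff_dist"
  by (auto intro!: Metric_space.subspace[OF Metric_space_compact_sets]
      simp: compact_convex_sets_def compact_starlike_sets_def)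


section \<open>Fuzzy sets\<close>

text \<open>
  A fuzzy set is a real-valued function with values in the unit interval.  The range condition is
  part of \<open>usc_fuzzy_set\<close>.
\<close>

definition upper_semicontinuous :: "('a::topological_space \<Rightarrow> real) \<Rightarrow> bool" where
  "upper_semicontinuous u \<longleftrightarrow> (\<forall>x. \<forall>c > u x. \<forall>\<^sub>F y in at x. u y < c)"

definition usc_fuzzy_set :: "('a::topological_space \<Rightarrow> real) \<Rightarrow> bool" where
  "usc_fuzzy_set u \<longleftrightarrow> range u \<subseteq> {0..1} \<and> upper_semicontinuous u"

definition level_set :: "('a::topological_space \<Rightarrow> real) \<Rightarrow> real \<Rightarrow> 'a set" where
  "level_set u \<alpha> = (if \<alpha> = 0 then closure {x. u x > 0} else {x. u x \<ge> \<alpha>})"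

definition normal_bounded_fuzzy_sets :: "('a::euclidean_space \<Rightarrow> real) set" where
  "normal_bounded_fuzzy_sets =
     {u. usc_fuzzy_set u \<and> (\<exists>x. u x = 1) \<and> bounded (level_set u 0)}"

definition convex_fuzzy_sets :: "('a::euclidean_space \<Rightarrow> real) set" where
  "convex_fuzzy_sets = {u \<in> normal_bounded_fuzzy_sets.
     \<forall>x y. \<forall>l\<in>{0..1}. u (l *\<^sub>R x + (1 - l) *\<^sub>R y) \<ge> min (u x) (u y)}"

definition star_fuzzy_sets :: "('a::euclidean_space \<Rightarrow> real) set" where
  "star_fuzzy_sets = {u \<in> normal_bounded_fuzzy_sets.
     \<exists>x. \<forall>y. \<forall>l\<in>{0..1}. u (l *\<^sub>R y + (1 - l) *\<^sub>R x) \<ge> u y}"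

definition level_star_fuzzy_sets :: "('a::euclidean_space \<Rightarrow> real) set" where
  "level_star_fuzzy_sets = {u \<in> normal_bounded_fuzzy_sets.
     \<forall>l\<in>{0<..1}. \<exists>x\<in>level_set u l. \<forall>y\<in>level_set u l. closed_segment x y \<subseteq> level_set u l}"

text \<open>The distance on the product type is the Euclidean one.\<close>

definition endograph :: "('a \<Rightarrow> real) \<Rightarrow> ('a \<times> real) set" where
  "endograph u = {(x, t). t \<in> {0..1} \<and> u x \<ge> t}"

definition H_end :: "('a::metric_space \<Rightarrow> real) \<Rightarrow> ('a \<Rightarrow> real) \<Rightarrow> real" where
  "H_end u v = hausdorff_dist (endograph u) (endograph v)"

definition ball_excess :: "real \<Rightarrow> ('a::real_normed_vector \<Rightarrow> real) \<Rightarrow> real" where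
  "ball_excess r u =
     H_end (\<lambda>x. max (u x) (indicat_real (cball 0 r) x)) (indicat_real (cball 0 r))"

definition relatively_compactin :: "'a topology \<Rightarrow> 'a set \<Rightarrow> bool" where
  "relatively_compactin T S \<longleftrightarrow> compactin T (T closure_of S)"

lemma usc_fuzzy_setD:
  assumes "usc_fuzzy_set u"
  shows "0 \<le> u x" "u x \<le> 1"
  using assms by (auto simp: usc_fuzzy_set_def image_subset_iff)

lemma endograph_nonempty:
  assumes "usc_fuzzy_set u"
  shows "endograph u \<noteq> {}"
proof -
  have "(x, 0) \<in> endograph u" for x
    using usc_fuzzy_setD[OF assms] by (simp add: endograph_def)
  then show ?thesis by blast
qed

lemma endograph_inj:
  assumes "usc_fuzzy_set u" "usc_fuzzy_set v" "endograph u = endograph v"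
  shows "u = v"
proof
  fix x
  have "(x, u x) \<in> endograph u" "(x, v x) \<in> endograph v"
    using usc_fuzzy_setD[OF assms(1)] usc_fuzzy_setD[OF assms(2)] by (auto simp: endograph_def)
  then have "(x, u x) \<in> endograph v" "(x, v x) \<in> endograph u"
    using assms(3) by auto
  then show "u x = v x"
    by (simp add: endograph_def)
qed

lemma closed_endograph:
  assumes "usc_fuzzy_set u"
  shows "closed (endograph u)"
proof -
  have "\<exists>T. open T \<and> p \<in> T \<and> T \<subseteq> - endograph u" if "p \<in> - endograph u" for p
  proof -
    obtain x t where p: "p = (x, t)" by (cases p)
    show ?thesis
    proof (cases "t \<in> {0..1}")
      case False
      then show ?thesis
        by (intro exI[of _ "UNIV \<times> (- {0..1})"]) (auto simp: p endograph_def open_Times open_Compl)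
    next
      case True
      then have "u x < t" using that by (auto simp: p endograph_def)
      then obtain c where c: "u x < c" "c < t" using dense by blast
      have "\<forall>\<^sub>F y in at x. u y < c"
        using assms c(1) by (auto simp: usc_fuzzy_set_def upper_semicontinuous_def)
      then obtain S where "open S" "x \<in> S" "\<And>y. y \<in> S \<Longrightarrow> y \<noteq> x \<Longrightarrow> u y < c"
        by (auto simp: eventually_at_topological)
      then have S: "\<forall>y\<in>S. u y < c" using c(1) by blast
      then show ?thesis using \<open>open S\<close> \<open>x \<in> S\<close> c(2)
        by (intro exI[of _ "S \<times> {c<..}"]) (auto simp: p endograph_def open_Times dest!: bspec[OF S])
    qed
  qed
  then have "open (- endograph u)"
    by (subst open_subopen) blast
  then show ?thesis
    by (simp add: closed_def)
qed

lemma Metric_space_H_end: "Metric_space (Collect usc_fuzzy_set) H_end"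
proof -
  let ?E = "endograph ` Collect usc_fuzzy_set :: ('a \<times> real) set set"
  interpret E: Metric_space ?E hausdorff_dist
  proof (rule Metric_space_hausdorff_dist)
    fix A B :: "('a \<times> real) set"
    assume "A \<in> ?E" "B \<in> ?E"
    then obtain u v where uv: "A = endograph u" "B = endograph v" "usc_fuzzy_set v"
      by auto
    have "infdist p B \<le> 1" if "p \<in> A" for p
    proof -
      obtain x t where p: "p = (x, t)" by (cases p)
      have "(x, 0) \<in> B" using uv usc_fuzzy_setD by (simp add: endograph_def)
      then have "infdist p B \<le> dist (x, t) (x, 0)" by (simp add: p infdist_le)
      also have "\<dots> \<le> 1" using that uv(1) by (auto simp: p endograph_def dist_Pair_Pair)
      finally show ?thesis .
    qed
    then show "\<exists>s. \<forall>p\<in>A. infdist p B \<le> s" by blast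
  qed (auto dest: endograph_nonempty closed_endograph)
  show ?thesis
  proof
    show "H_end u v = 0 \<longleftrightarrow> u = v"
      if "u \<in> Collect usc_fuzzy_set" "v \<in> Collect usc_fuzzy_set" for u v :: "'a \<Rightarrow> real"
      using E.zero[of "endograph u" "endograph v"] that endograph_inj[of u v]
      unfolding H_end_def by blast
    show "H_end u w \<le> H_end u v + H_end v w"
      if "u \<in> Collect usc_fuzzy_set" "v \<in> Collect usc_fuzzy_set" "w \<in> Collect usc_fuzzy_set"
      for u v w :: "'a \<Rightarrow> real"
      unfolding H_end_def using that by (intro E.triangle imageI)
    show "0 \<le> H_end u v" for u v :: "'a \<Rightarrow> real"
      unfolding H_end_def by (rule E.nonneg)
    show "H_end u v = H_end v u" for u v :: "'a \<Rightarrow> real"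
      unfolding H_end_def by (rule E.commute)
  qed
qed

lemma Metric_space_convex_fuzzy_sets: "Metric_space convex_fuzzy_sets H_end"
  and Metric_space_star_fuzzy_sets: "Metric_space star_fuzzy_sets H_end"
  and Metric_space_level_star_fuzzy_sets: "Metric_space level_star_fuzzy_sets H_end"
  by (auto intro!: Metric_space.subspace[OF Metric_space_H_end]
      simp: convex_fuzzy_sets_def star_fuzzy_sets_def level_star_fuzzy_sets_def
        normal_bounded_fuzzy_sets_def)

end

theory Submission
  imports Defs "HOL-Complex_Analysis.Great_Picard"
begin

text \<open>
  Relative compactness is sequential: the closure of \<open>U\<close> in \<open>X\<close> is compact iff every sequence in
  \<open>U\<close> has a subsequence that converges to some member of \<open>X\<close>
  (\<open>compactin_closure_of_sequentially\<close>).  Boundedness of the level sets in the Hausdorff metric only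
  says that their union is bounded (\<open>mbounded_hausdorff_iff\<close>).

  If subsequences converge, a limit has support in some ball of radius \<open>r\<close>.  The \<open>r\<close>-excess of a
  fuzzy set is at most its endograph distance to such a limit, and therefore tends to 0.  Points
  where members of \<open>U\<close> are at least \<open>\<alpha> > 0\<close> cannot escape to infinity, as they come close to points
  where the limit is positive.

  Conversely, let the excess over the ball of radius \<open>r\<close> tend to 0 along a sequence.  Every endograph
  contains the whole horizontal hyperplane at height 0, so two endographs can only differ at positive
  heights, and above any height \<open>e > 0\<close> the endographs eventually lie over the ball of radius
  \<open>r + 1\<close>.  Thus the whole question concerns a compact set, on which the distance
  functions to the endographs are uniformly Lipschitz.  By Arzela and Ascoli, a subsequence of them
  converges uniformly, and the zero set of the limit is again an endograph
  (\<open>H_end_convergent_subsequence\<close>).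

  Bounded level sets are needed to see that the limit stays in \<open>X\<close>.  The points with value 1 and
  the star centres of the members of the sequence are bounded, so they accumulate, and the
  accumulation points serve the limit.  The defining inequalities pass to the limit because every
  point of the limit endograph is approximated by points of the endographs
  (\<open>H_end_recovery\<close>) and limits of such points lie in the limit endograph (\<open>H_end_limit_ge\<close>).
\<close>

section \<open>Hausdorff boundedness and sequential compactness of closures\<close>

lemma hausdorff_dist_nonneg: "0 \<le> hausdorff_dist A B"
  by (simp add: hausdorff_dist_def)

text \<open>
  Boundedness keeps the suprema finite; for an infinite supremum the distance has the default
  value 0 and would bound nothing.
\<close>

lemma infdist_le_hausdorff_dist:
  assumes "bounded A" "bounded B" "B \<noteq> {}" "a \<in> A"
  shows "infdist a B \<le> hausdorff_dist A B"
proof -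
  have bound: "infdist p D \<le> diameter (A \<union> B)"
    if "p \<in> A \<union> B" "D \<subseteq> A \<union> B" "D \<noteq> {}" for p D
  proof -
    obtain q where "q \<in> D" using \<open>D \<noteq> {}\<close> by blast
    then have "infdist p D \<le> dist p q" by (rule infdist_le)
    also have "\<dots> \<le> diameter (A \<union> B)"
      using that \<open>q \<in> D\<close> assms(1,2) by (intro diameter_bounded_bound) auto
    finally show ?thesis .
  qed
  have "(\<forall>a\<in>A. infdist a B \<le> hausdorff_dist A B) \<and> (\<forall>b\<in>B. infdist b A \<le> hausdorff_dist A B)"
    using assms bound
    by (subst hausdorff_dist_le_iff[symmetric, where s = "diameter (A \<union> B)"])
      (auto simp: hausdorff_dist_nonneg)
  then show ?thesis using assms(4) by blast
qed

text \<open>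
  The singleton of the origin can be taken as the centre of a ball in the Hausdorff metric, and the
  distance of \<open>A\<close> from it is controlled by the norms of the points of \<open>A\<close>.
\<close>

lemma mbounded_hausdorff_iff:
  fixes K :: "'a::euclidean_space set set"
  assumes K: "Metric_space K hausdorff_dist" "\<And>A. A \<in> K \<Longrightarrow> A \<noteq> {} \<and> compact A"
    and "{0} \<in> K" "S \<subseteq> K"
  shows "Metric_space.mbounded K hausdorff_dist S \<longleftrightarrow> bounded (\<Union>S)"
proof
  interpret Metric_space K hausdorff_dist by (rule K)
  assume "mbounded S"
  then obtain C b where C: "S \<subseteq> mcball C b" by (auto simp: mbounded_def)
  show "bounded (\<Union>S)"
  proof (cases "S = {}")
    case False
    then have "C \<in> K" using C by auto
    then have C': "C \<noteq> {}" "compact C" using K(2) by auto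
    then obtain M where M: "\<And>c. c \<in> C \<Longrightarrow> norm c \<le> M"
      using compact_imp_bounded bounded_iff by metis
    have "norm a \<le> b + M" if "a \<in> A" "A \<in> S" for a A
    proof -
      have A: "A \<in> K" "hausdorff_dist C A \<le> b" using that C by auto
      have "infdist a C \<le> hausdorff_dist A C"
        using C' A K(2) that by (intro infdist_le_hausdorff_dist compact_imp_bounded) auto
      moreover obtain c where "c \<in> C" "infdist a C = dist a c"
        using infdist_attains_inf[OF compact_imp_closed] C' by metis
      ultimately show ?thesis
        using M[of c] A(2) norm_triangle_sub[of a c] by (simp add: commute dist_norm)
    qed
    then show ?thesis unfolding bounded_iff by blast
  qed simp
next
  interpret Metric_space K hausdorff_dist by (rule K)
  assume "bounded (\<Union>S)"
  then obtain b where b: "0 < b" "\<And>a. a \<in> \<Union>S \<Longrightarrow> norm a \<le> b"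
    by (auto simp: bounded_pos)
  have "hausdorff_dist {0} A \<le> b" if "A \<in> S" for A
  proof -
    obtain a where a: "a \<in> A" using K(2)[of A] \<open>A \<in> S\<close> assms(4) by blast
    have "infdist 0 A \<le> b"
      using infdist_le[OF a, of 0] b(2)[of a] UnionI[OF that a] by simp
    then show ?thesis
      using b that by (subst hausdorff_dist_le_iff[where s = b]) (auto simp: dist_norm)
  qed
  then show "mbounded S"
    using assms by (auto simp: mbounded_def intro!: exI[of _ "{0}"] exI[of _ b])
qed

text \<open>
  A sequence in the closure is shadowed by a sequence in \<open>S\<close> at distances tending to 0, so the
  subsequences of both have the same limits.
\<close>

lemma (in Metric_space) compactin_closure_of_sequentially:
  assumes "S \<subseteq> M"
  shows "compactin mtopology (mtopology closure_of S) \<longleftrightarrow>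
    (\<forall>\<sigma> :: nat \<Rightarrow> 'a. range \<sigma> \<subseteq> S \<longrightarrow>
      (\<exists>l\<in>M. \<exists>r. strict_mono r \<and> (\<lambda>n. d (\<sigma> (r n)) l) \<longlonglongrightarrow> 0))"
    (is "?L \<longleftrightarrow> ?R")
proof
  assume L: ?L
  show ?R
  proof (intro allI impI)
    fix \<sigma> :: "nat \<Rightarrow> 'a" assume "range \<sigma> \<subseteq> S"
    then have "range \<sigma> \<subseteq> mtopology closure_of S"
      using closure_of_subset[of S mtopology] assms by auto
    then obtain l r where "strict_mono r" "limitin mtopology (\<sigma> \<circ> r) l sequentially"
      using L unfolding compactin_sequentially by blast
    then show "\<exists>l\<in>M. \<exists>r. strict_mono r \<and> (\<lambda>n. d (\<sigma> (r n)) l) \<longlonglongrightarrow> 0"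
      unfolding limitin_metric_dist_null by (auto simp: o_def)
  qed
next
  assume R: ?R
  show ?L
    unfolding compactin_sequentially
  proof (intro conjI allI impI)
    show "mtopology closure_of S \<subseteq> M"
      using closure_of_subset_topspace[of mtopology S] by simp
    fix \<sigma> :: "nat \<Rightarrow> 'a" assume \<sigma>: "range \<sigma> \<subseteq> mtopology closure_of S"
    then have \<sigma>M: "\<sigma> n \<in> M" for n
      by (auto simp: metric_closure_of)
    have "\<exists>y\<in>S. d (\<sigma> n) y < inverse (real (Suc n))" for n
    proof -
      have "\<sigma> n \<in> mtopology closure_of S" using \<sigma> by auto
      then have "\<exists>y\<in>S. y \<in> mball (\<sigma> n) (inverse (real (Suc n)))"
        by (simp add: metric_closure_of del: in_mball)
      then show ?thesis by auto
    qed
    then obtain \<tau> where \<tau>: "\<And>n. \<tau> n \<in> S" "\<And>n. d (\<sigma> n) (\<tau> n) < inverse (real (Suc n))"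
      by metis
    then obtain l r where l: "l \<in> M" "strict_mono r" "(\<lambda>n. d (\<tau> (r n)) l) \<longlonglongrightarrow> 0"
      using R[rule_format, of \<tau>] by auto
    have "(\<lambda>n. inverse (real (Suc (r n))) + d (\<tau> (r n)) l) \<longlonglongrightarrow> 0 + 0"
      using LIMSEQ_subseq_LIMSEQ[OF LIMSEQ_inverse_real_of_nat l(2)]
      by (intro tendsto_add l(3)) (simp add: o_def)
    moreover have "d (\<sigma> (r n)) l \<le> inverse (real (Suc (r n))) + d (\<tau> (r n)) l" for n
      using triangle[OF \<sigma>M[of "r n"] _ l(1), of "\<tau> (r n)"] \<tau>(2)[of "r n"] \<tau>(1) assms
      by fastforce
    ultimately have "(\<lambda>n. d (\<sigma> (r n)) l) \<longlonglongrightarrow> 0"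
      by (intro tendsto_sandwich[of "\<lambda>_. 0" "\<lambda>n. d (\<sigma> (r n)) l"]) auto
    then have lim: "limitin mtopology (\<sigma> \<circ> r) l sequentially"
      using l(1) \<sigma>M by (simp add: limitin_metric_dist_null o_def)
    have "l \<in> mtopology closure_of S"
      unfolding metric_closure_of
    proof (intro CollectI conjI allI impI l(1))
      fix e :: real assume "0 < e"
      then have "\<forall>\<^sub>F n in sequentially. d (\<tau> (r n)) l < e"
        using l(3) order_tendstoD(2) by blast
      then obtain n where "d (\<tau> (r n)) l < e"
        using eventually_happens' sequentially_bot by blast
      then show "\<exists>y\<in>S. y \<in> mball l e"
        using \<tau>(1) assms l(1) by (intro bexI[of _ "\<tau> (r n)"]) (auto simp: commute)
    qed
    with lim l(2) show "\<exists>l r. l \<in> mtopology closure_of S \<and> strict_mono r \<and>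
        limitin mtopology (\<sigma> \<circ> r) l sequentially"
      by blast
  qed
qed


section \<open>Endographs\<close>

lemma mem_endograph: "(x, t) \<in> endograph u \<longleftrightarrow> 0 \<le> t \<and> t \<le> 1 \<and> t \<le> u x"
  by (auto simp: endograph_def)

lemma infdist_endograph_le:
  assumes "\<And>x. 0 \<le> v x" "0 \<le> t"
  shows "infdist (x, t) (endograph v) \<le> t"
proof -
  have "infdist (x, t) (endograph v) \<le> dist (x, t) (x, 0)"
    using assms by (intro infdist_le) (simp add: mem_endograph)
  then show ?thesis using assms(2) by (simp add: dist_Pair_Pair)
qed

text \<open>
  Endographs are closed under lowering the height, so each of their points can be cut off at
  height \<open>s\<close>, and the result is no farther from \<open>(x, s)\<close> than the point itself is from \<open>(x, t)\<close>.
\<close>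

lemma infdist_endograph_mono:
  assumes "endograph v \<noteq> {}" "0 \<le> s" "s \<le> t"
  shows "infdist (x, s) (endograph v) \<le> infdist (x, t) (endograph v)"
  unfolding infdist_notempty[OF assms(1)]
proof (rule cINF_mono[OF assms(1)])
  fix q assume "q \<in> endograph v"
  then obtain y \<tau> where q: "q = (y, \<tau>)" "(y, \<tau>) \<in> endograph v" by (cases q) auto
  have "dist (x, s) (y, min \<tau> s) \<le> dist (x, t) (y, \<tau>)"
    unfolding dist_Pair_Pair dist_real_def
    using assms(3) by (intro real_sqrt_le_mono add_mono power_mono) auto
  moreover have "(y, min \<tau> s) \<in> endograph v"
    using q(2) assms(2) by (auto simp: mem_endograph)
  ultimately show "\<exists>p\<in>endograph v. dist (x, s) p \<le> dist (x, t) q"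
    using q by blast
qed (auto intro!: bdd_belowI[of _ 0])

text \<open>
  Each point of an endograph has a point of height 0 at distance at most 1 below it.  Hence the two
  suprema in the Hausdorff distance are finite.
\<close>

lemma H_end_le_iff:
  assumes "\<And>x. 0 \<le> u x" "\<And>x. 0 \<le> v x" "0 \<le> r"
  shows "H_end u v \<le> r \<longleftrightarrow>
    (\<forall>p\<in>endograph u. infdist p (endograph v) \<le> r) \<and>
    (\<forall>p\<in>endograph v. infdist p (endograph u) \<le> r)"
proof -
  have le1: "infdist p (endograph w) \<le> 1" if "p \<in> endograph w'" "\<And>x. 0 \<le> w x" for p w w'
  proof -
    obtain x t where p: "p = (x, t)" by (cases p)
    then show ?thesis
      using that infdist_endograph_le[of w t x] by (auto simp: mem_endograph)
  qed
  show ?thesis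
    unfolding H_end_def
    by (rule hausdorff_dist_le_iff[where s = 1]) (use assms(3) in \<open>auto intro: le1 assms(1,2)\<close>)
qed

lemma H_end_nonneg: "0 \<le> H_end u v"
  by (simp add: H_end_def hausdorff_dist_nonneg)

lemma H_end_commute: "H_end u v = H_end v u"
  by (simp add: H_end_def hausdorff_dist_def max.commute)

lemma infdist_le_H_end:
  assumes "\<And>x. 0 \<le> u x" "\<And>x. 0 \<le> v x" "p \<in> endograph u"
  shows "infdist p (endograph v) \<le> H_end u v"
  using H_end_le_iff[where u = u and v = v, OF assms(1,2) H_end_nonneg] assms(3) by blast

text \<open>
  The maximum of two functions has the union of their endographs as endograph.  This union contains
  the endograph of the ball, so only one side of the Hausdorff distance counts, and there only the
  points of the endograph of \<open>u\<close>.
\<close>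

lemma ball_excess_le_iff:
  assumes "\<And>x. 0 \<le> u x" "0 \<le> e"
  shows "ball_excess r u \<le> e \<longleftrightarrow>
    (\<forall>p\<in>endograph u. infdist p (endograph (indicat_real (cball 0 r))) \<le> e)"
proof -
  let ?I = "indicat_real (cball 0 r)"
  have un: "endograph (\<lambda>x. max (u x) (?I x)) = endograph u \<union> endograph ?I"
    by (auto simp: endograph_def)
  have zero: "infdist p (endograph u \<union> endograph ?I) = 0" "infdist p (endograph ?I) = 0"
    if "p \<in> endograph ?I" for p
    using that by auto
  have "ball_excess r u \<le> e \<longleftrightarrow>
      (\<forall>p\<in>endograph u \<union> endograph ?I. infdist p (endograph ?I) \<le> e) \<and>
      (\<forall>p\<in>endograph ?I. infdist p (endograph u \<union> endograph ?I) \<le> e)"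
    unfolding ball_excess_def un[symmetric]
    by (rule H_end_le_iff) (simp_all add: assms le_max_iff_disj)
  then show ?thesis
    using zero assms(2) by (simp add: ball_Un)
qed

lemma infdist_le_ball_excess:
  assumes "\<And>x. 0 \<le> u x" "p \<in> endograph u"
  shows "infdist p (endograph (indicat_real (cball 0 r))) \<le> ball_excess r u"
proof -
  have "0 \<le> ball_excess r u" by (simp add: ball_excess_def H_end_nonneg)
  then show ?thesis using ball_excess_le_iff[where u = u and r = r, OF assms(1)] assms(2) by blast
qed

lemma endograph_indicator: "endograph (indicat_real C) = UNIV \<times> {0} \<union> C \<times> {0..1}"
  by (auto simp: endograph_def indicator_def)

lemma closed_superlevel:
  fixes u :: "'a::topological_space \<Rightarrow> real"
  assumes "closed (endograph u)" "0 \<le> c" "c \<le> 1"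
  shows "closed {y. c \<le> u y}"
proof -
  have "closed ((\<lambda>y. (y, c)) -` endograph u)"
    by (intro closed_vimage assms(1) continuous_intros)
  then show ?thesis
    using assms(2,3) by (simp add: vimage_def mem_endograph)
qed

lemma usc_fuzzy_set_if_closed_endograph:
  fixes u :: "'a::topological_space \<Rightarrow> real"
  assumes "range u \<subseteq> {0..1}" "closed (endograph u)"
  shows "usc_fuzzy_set u"
  unfolding usc_fuzzy_set_def upper_semicontinuous_def
proof (intro conjI allI impI assms(1))
  fix x c assume c: "u x < c"
  have u: "0 \<le> u y" "u y \<le> 1" for y using assms(1) by (auto simp: image_subset_iff)
  show "\<forall>\<^sub>F y in at x. u y < c"
  proof (cases "c \<le> 1")
    case True
    have "0 \<le> c" using u(1)[of x] c by linarith
    then have "closed {y. c \<le> u y}"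
      using True by (intro closed_superlevel assms(2))
    then have "open (- {y. c \<le> u y})" by (rule open_Compl)
    then have "open {y. u y < c}" by (simp add: Collect_neg_eq[symmetric] not_le)
    then show ?thesis using c by (auto simp: eventually_at_topological)
  next
    case False
    then have "u y < c" for y using u(2)[of y] by linarith
    then show ?thesis by simp
  qed
qed

text \<open>
  The function is the supremum of each vertical fibre.  Closedness makes the supremum a member of
  its fibre, and downward closure then fills the fibre below it.
\<close>

lemma closed_hypograph_is_endograph:
  fixes A :: "('a::topological_space \<times> real) set"
  assumes "closed A" "A \<subseteq> UNIV \<times> {0..1}" "\<And>x. (x, 0) \<in> A"
    and down: "\<And>x s t. (x, t) \<in> A \<Longrightarrow> 0 \<le> s \<Longrightarrow> s \<le> t \<Longrightarrow> (x, s) \<in> A"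
  obtains u where "usc_fuzzy_set u" "endograph u = A"
proof -
  define u where "u x = Sup {t. (x, t) \<in> A}" for x
  have bdd: "bdd_above {t. (x, t) \<in> A}" for x
    using assms(2) by (intro bdd_aboveI[of _ 1]) auto
  have "closed (Pair x -` A)" for x
    by (intro closed_vimage assms(1) continuous_intros)
  then have mem: "(x, u x) \<in> A" for x
    using closed_contains_Sup[OF _ bdd, of x] assms(3)[of x] by (auto simp: u_def vimage_def)
  have u: "t \<le> u x" if "(x, t) \<in> A" for x t
    unfolding u_def using that by (intro cSup_upper bdd) auto
  have eq: "endograph u = A"
  proof (intro set_eqI iffI)
    fix p assume "p \<in> endograph u"
    then show "p \<in> A" using down[OF mem] by (cases p) (simp add: mem_endograph)
  next
    fix p assume "p \<in> A"
    then show "p \<in> endograph u" using assms(2) u by (cases p) (auto simp: mem_endograph)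
  qed
  moreover have "range u \<subseteq> {0..1}" using mem assms(2) by auto
  ultimately show thesis
    using that usc_fuzzy_set_if_closed_endograph assms(1) by blast
qed


section \<open>Extraction of convergent subsequences\<close>

lemma infdist_triangle_set:
  assumes "E \<noteq> {}" "\<And>q. q \<in> E \<Longrightarrow> infdist q B \<le> e"
  shows "infdist p B \<le> infdist p E + e"
proof -
  have "infdist p B - e \<le> dist p q" if "q \<in> E" for q
    using infdist_triangle[of p B q] assms(2)[OF that] by linarith
  then have "infdist p B - e \<le> infdist p E"
    using assms(1) by (auto simp: infdist_notempty intro!: cINF_greatest)
  then show ?thesis by linarith
qed

text \<open>
  The limit endograph \<open>A\<close> is the set of points whose distance from the endographs tends to 0
  along the chosen subsequence.  On the compact cylinder \<open>S\<close> it is the zero set of the uniform limit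
  \<open>g\<close> of the distance functions, so \<open>g\<close> has a positive lower bound on the points of \<open>S\<close>
  that are far from \<open>A\<close>, and no late endograph can contain one of them.
\<close>

lemma H_end_convergent_subsequence:
  fixes v :: "nat \<Rightarrow> 'a::euclidean_space \<Rightarrow> real"
  assumes v: "\<And>n x. 0 \<le> v n x" and ex: "(\<lambda>n. ball_excess r (v n)) \<longlonglongrightarrow> 0"
  obtains u s where "usc_fuzzy_set u" "{x. 0 < u x} \<subseteq> cball 0 r" "strict_mono s"
    "(\<lambda>n. H_end (v (s n)) u) \<longlonglongrightarrow> 0"
proof -
  \<comment> \<open>The margin 1 keeps points near the endograph of the ball inside the cylinder.\<close>
  define S where "S = cball (0::'a) (r + 1) \<times> {0..1::real}"
  define B where "B = endograph (indicat_real (cball (0::'a) r))"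
  have "compact S" by (auto simp: S_def intro: compact_Times)
  have lip: "\<bar>infdist p E - infdist q E\<bar> \<le> dist p q" for p q and E :: "('a \<times> real) set"
    by (rule infdist_triangle_abs)
  have ne: "endograph (v n) \<noteq> {}" for n
    using v mem_endograph[of undefined 0 "v n"] by fastforce
  obtain g and k :: "nat \<Rightarrow> nat" where "continuous_on S g" and k: "strict_mono k"
    and unif: "\<And>e. 0 < e \<Longrightarrow> \<exists>N. \<forall>n p. n \<ge> N \<and> p \<in> S \<longrightarrow>
      norm (infdist p (endograph (v (k n))) - g p) < e"
  proof (rule Arzela_Ascoli[OF \<open>compact S\<close>, of "\<lambda>n p. infdist p (endograph (v n))" 1])
    show "norm (infdist p (endograph (v n))) \<le> 1" if "p \<in> S" for n p
    proof -
      obtain x t where p: "p = (x, t)" by (cases p)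
      then show ?thesis
        using infdist_endograph_le[of "v n" t x] that v by (auto simp: S_def infdist_nonneg)
    qed
    show "\<exists>d>0. \<forall>n q. q \<in> S \<and> norm (p - q) < d \<longrightarrow>
        norm (infdist p (endograph (v n)) - infdist q (endograph (v n))) < e"
      if "0 < e" for p e
    proof (intro exI[of _ e] conjI that allI impI)
      fix n q assume "q \<in> S \<and> norm (p - q) < e"
      then show "norm (infdist p (endograph (v n)) - infdist q (endograph (v n))) < e"
        using lip[of p "endograph (v n)" q] by (simp add: dist_norm)
    qed
  qed blast
  define F where "F n p = infdist p (endograph (v (k n)))" for n p
  have ex': "(\<lambda>n. ball_excess r (v (k n))) \<longlonglongrightarrow> 0"
    using LIMSEQ_subseq_LIMSEQ[OF ex k] by (simp add: o_def)
  have Fg: "(\<lambda>n. F n p) \<longlonglongrightarrow> g p" if "p \<in> S" for p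
    unfolding LIMSEQ_iff F_def using unif that by blast
  define A where "A = {p. snd p \<in> {0..1} \<and> (\<lambda>n. F n p) \<longlonglongrightarrow> 0}"
  have F0: "F n (x, 0) = 0" for n x
    unfolding F_def using v by (intro infdist_zero) (simp add: mem_endograph)
  have Fnn: "0 \<le> F n p" for n p by (simp add: F_def infdist_nonneg)
  have "closed A"
  proof -
    have lim0: "(\<lambda>n. F n p) \<longlonglongrightarrow> 0" if p: "p \<in> closure A" for p
    proof (rule LIMSEQ_I)
      fix e :: real assume e: "0 < e"
      then obtain q where q: "q \<in> A" "dist q p < e / 2"
        using p closure_approachable[of p A] half_gt_zero by blast
      have "(\<lambda>n. F n q) \<longlonglongrightarrow> 0" using q(1) by (simp add: A_def)
      then obtain N where "\<forall>n\<ge>N. norm (F n q - 0) < e / 2"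
        using LIMSEQ_D e half_gt_zero by blast
      moreover have "norm (F n p - 0) < e" if "norm (F n q - 0) < e / 2" for n
        using lip[of p "endograph (v (k n))" q] q(2) that Fnn[of n p]
        unfolding F_def dist_commute[of p q] by simp
      ultimately have "\<forall>n\<ge>N. norm (F n p - 0) < e" by blast
      then show "\<exists>N. \<forall>n\<ge>N. norm (F n p - 0) < e" by blast
    qed
    have "closure A \<subseteq> UNIV \<times> {0..1}"
    proof (rule closure_minimal)
      show "A \<subseteq> UNIV \<times> {0..1}" by (simp add: A_def subset_iff mem_Times_iff)
    qed (intro closed_Times closed_UNIV closed_real_atLeastAtMost)
    then have "snd p \<in> {0..1}" if "p \<in> closure A" for p
      using that mem_Times_iff by blast
    with lim0 have "closure A \<subseteq> {p. snd p \<in> {0..1} \<and> (\<lambda>n. F n p) \<longlonglongrightarrow> 0}" by blast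
    then have "closure A \<subseteq> A" by (simp only: A_def[symmetric])
    then show ?thesis using closure_subset_eq by blast
  qed
  moreover have "(x, s) \<in> A" if "(x, t) \<in> A" "0 \<le> s" "s \<le> t" for x s t
  proof -
    have "(\<lambda>n. F n (x, t)) \<longlonglongrightarrow> 0" using that(1) by (simp add: A_def)
    moreover have "F n (x, s) \<le> F n (x, t)" for n
      unfolding F_def using that(2,3) by (intro infdist_endograph_mono ne)
    ultimately have "(\<lambda>n. F n (x, s)) \<longlonglongrightarrow> 0"
      using Fnn by (intro tendsto_sandwich[of "\<lambda>_. 0" "\<lambda>n. F n (x, s)"]) auto
    then show ?thesis using that by (auto simp: A_def)
  qed
  ultimately obtain u where u: "usc_fuzzy_set u" "endograph u = A"
    using F0 by (elim closed_hypograph_is_endograph) (auto simp: A_def)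
  have unn: "0 \<le> u x" for x using usc_fuzzy_setD[OF u(1)] by blast
  have memB: "dist 0 x \<le> r" if "(x, t) \<in> B" "t \<noteq> 0" for x t
    using that by (simp add: B_def endograph_indicator)
  have "B \<noteq> {}" by (auto simp: B_def endograph_indicator)
  have "closed B"
    unfolding B_def endograph_indicator by (intro closed_Un closed_Times) auto
  have excess: "infdist q B \<le> ball_excess r (v n)" if "q \<in> endograph (v n)" for q n
    unfolding B_def using v that by (intro infdist_le_ball_excess)
  \<comment> \<open>The vanishing excess forces the limit into the endograph of the ball, which bounds its support.\<close>
  have AB: "p \<in> B" if "p \<in> A" for p
  proof -
    have "(\<lambda>n. F n p + ball_excess r (v (k n))) \<longlonglongrightarrow> 0 + 0"
      using that by (intro tendsto_add ex') (simp add: A_def)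
    moreover have "infdist p B \<le> F n p + ball_excess r (v (k n))" for n
      unfolding F_def by (intro infdist_triangle_set ne excess)
    ultimately have "infdist p B \<le> 0"
      by (intro LIMSEQ_le_const[where x = 0]) auto
    then show ?thesis
      using in_closed_iff_infdist_zero[OF \<open>closed B\<close> \<open>B \<noteq> {}\<close>] infdist_nonneg[of p B]
      by (metis order.antisym)
  qed
  have supp: "x \<in> cball 0 r" if "0 < u x" for x
  proof -
    have "(x, u x) \<in> endograph u"
      using usc_fuzzy_setD[OF u(1), of x] by (simp add: mem_endograph)
    then have "(x, u x) \<in> A" by (simp only: u(2))
    then show ?thesis using memB[OF AB] that by simp
  qed
  have "(\<lambda>n. H_end (v (k n)) u) \<longlonglongrightarrow> 0"
  proof (rule LIMSEQ_I)
    fix e' :: real assume "0 < e'"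
    define e where "e = e' / 2"
    have e: "0 < e" "e < e'" using \<open>0 < e'\<close> by (auto simp: e_def)
    \<comment> \<open>The part of the cylinder that late endographs have to avoid.\<close>
    define C where "C = S \<inter> {p. e \<le> infdist p A}"
    have "closed {p. e \<le> infdist p A}"
      by (intro closed_Collect_le continuous_intros)
    then have "compact C"
      unfolding C_def by (intro compact_Int_closed \<open>compact S\<close>)
    have gpos: "0 < g p" if "p \<in> C" for p
    proof -
      have lim: "(\<lambda>n. F n p) \<longlonglongrightarrow> g p" using Fg that by (simp add: C_def)
      have "g p \<noteq> 0"
      proof
        assume "g p = 0"
        then have "p \<in> A" using lim that by (auto simp: A_def C_def S_def)
        then show False using that e by (simp add: C_def)
      qed
      moreover have "0 \<le> g p" using lim Fnn by (intro LIMSEQ_le_const[where X = "\<lambda>n. F n p"]) auto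
      ultimately show ?thesis by simp
    qed
    obtain \<delta> where \<delta>: "0 < \<delta>" "\<And>p. p \<in> C \<Longrightarrow> \<delta> \<le> g p"
    proof (cases "C = {}")
      case False
      have "continuous_on C g"
        using \<open>continuous_on S g\<close> by (rule continuous_on_subset) (simp add: C_def)
      then obtain p where "p \<in> C" "\<And>q. q \<in> C \<Longrightarrow> g p \<le> g q"
        using continuous_attains_inf[OF \<open>compact C\<close> False] by blast
      then show thesis using that[of "g p"] gpos by blast
    qed (use that[of 1] in auto)
    obtain N1 where N1: "\<And>n p. n \<ge> N1 \<Longrightarrow> p \<in> S \<Longrightarrow> \<bar>F n p - g p\<bar> < min \<delta> e"
      using unif[of "min \<delta> e"] \<delta>(1) e(1) by (auto simp: F_def)
    have "\<forall>\<^sub>F n in sequentially. ball_excess r (v (k n)) < min e 1"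
      using ex' e(1) by (intro order_tendstoD(2)) auto
    then obtain N2 where N2: "\<And>n. n \<ge> N2 \<Longrightarrow> ball_excess r (v (k n)) < min e 1"
      by (auto simp: eventually_sequentially)
    have "H_end (v (k n)) u \<le> e" if n: "n \<ge> N1" "n \<ge> N2" for n
    proof -
      have "infdist p A \<le> e" if p: "p \<in> endograph (v (k n))" for p
      proof (rule ccontr)
        assume far: "\<not> infdist p A \<le> e"
        obtain x t where xt: "p = (x, t)" by (cases p)
        have t: "0 \<le> t" "t \<le> 1" using p xt by (auto simp: mem_endograph)
        \<comment> \<open>A point far from the limit has height above \<open>e\<close>, so by the small excess it lies in the cylinder.\<close>
        have "infdist p A \<le> t"
          using infdist_endograph_le[where v = u and x = x, OF unn t(1)] u(2) xt by simp
        then have "e < t" using far by linarith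
        have "infdist p B < min e 1"
          using excess[OF p] N2[OF n(2)] by linarith
        then obtain q where q: "q \<in> B" "dist p q < min e 1"
          using infdist_attains_inf[OF \<open>closed B\<close> \<open>B \<noteq> {}\<close>] by metis
        obtain y s where ys: "q = (y, s)" by (cases q)
        have "dist x y < 1" "dist t s < e"
          using q(2) dist_fst_le[of p q] dist_snd_le[of p q] by (auto simp: xt ys)
        then have "s \<noteq> 0" using \<open>e < t\<close> by (auto simp: dist_real_def)
        then have "dist 0 y \<le> r" using q(1) ys memB by simp
        then have "dist 0 x \<le> r + 1"
          using \<open>dist x y < 1\<close> dist_triangle2[of 0 x y] by linarith
        then have "p \<in> C"
          using far t by (simp add: C_def S_def xt)
        moreover have "F n p = 0" using p by (simp add: F_def)
        ultimately show False
          using N1[OF n(1), of p] \<delta>(2)[of p] by (auto simp: C_def)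
      qed
      moreover have "infdist p (endograph (v (k n))) \<le> e" if p: "p \<in> A" for p
      proof -
        obtain x t where xt: "p = (x, t)" by (cases p)
        have pt: "0 \<le> t" "t \<le> 1" using p u(2) by (auto simp: xt mem_endograph)
        show ?thesis
        proof (cases "t = 0")
          case True
          then show ?thesis using F0[of n x] e by (simp add: xt F_def)
        next
          case False
          then have "p \<in> S"
            using memB[of x t] AB[OF p] pt by (simp add: S_def xt)
          moreover have "g p = 0"
            using LIMSEQ_unique[OF Fg[OF \<open>p \<in> S\<close>]] p by (simp add: A_def)
          ultimately have "\<bar>F n p\<bar> < e" using N1[OF n(1), of p] by simp
          then show ?thesis by (simp add: F_def)
        qed
      qed
      ultimately show ?thesis
        using v unn e(1) u(2) by (subst H_end_le_iff) auto
    qed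
    then have "\<forall>n \<ge> max N1 N2. norm (H_end (v (k n)) u - 0) < e'"
      using e by (force simp: H_end_nonneg)
    then show "\<exists>N. \<forall>n\<ge>N. norm (H_end (v (k n)) u - 0) < e'" by blast
  qed
  then show thesis using that u(1) supp k by blast
qed


section \<open>Limits of fuzzy sets\<close>

text \<open>
  The bound \<open>t n\<close> need not be a height in the unit interval.  Its positive part is one, and the
  corresponding points lie in the endographs and converge to a point of the closed limit endograph.
\<close>

lemma H_end_limit_ge:
  fixes v :: "nat \<Rightarrow> 'a::metric_space \<Rightarrow> real"
  assumes u: "usc_fuzzy_set u" and v: "\<And>n. usc_fuzzy_set (v n)"
    and lim: "(\<lambda>n. H_end (v n) u) \<longlonglongrightarrow> 0"
    and x: "x \<longlonglongrightarrow> a" and t: "t \<longlonglongrightarrow> c" and le: "\<forall>\<^sub>F n in sequentially. t n \<le> v n (x n)"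
  shows "c \<le> u a"
proof -
  note uD = usc_fuzzy_setD[OF u] and vD = usc_fuzzy_setD[OF v]
  define p where "p n = (x n, max 0 (t n))" for n
  have p: "p \<longlonglongrightarrow> (a, max 0 c)"
    unfolding p_def by (intro tendsto_intros x t)
  have "(\<lambda>n. infdist (p n) (endograph u)) \<longlonglongrightarrow> infdist (a, max 0 c) (endograph u)"
    by (intro tendsto_infdist p)
  moreover have "(\<lambda>n. infdist (p n) (endograph u)) \<longlonglongrightarrow> 0"
  proof (rule tendsto_sandwich[OF _ _ tendsto_const lim])
    show "\<forall>\<^sub>F n in sequentially. infdist (p n) (endograph u) \<le> H_end (v n) u"
      using le
    proof eventually_elim
      case (elim n)
      have "p n \<in> endograph (v n)"
        using elim vD[of n "x n"] by (simp add: p_def mem_endograph)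
      then show ?case using uD vD by (intro infdist_le_H_end)
    qed
  qed (simp add: infdist_nonneg)
  ultimately have "infdist (a, max 0 c) (endograph u) = 0"
    by (rule LIMSEQ_unique)
  then have "(a, max 0 c) \<in> endograph u"
    using in_closed_iff_infdist_zero[OF closed_endograph endograph_nonempty] u by blast
  then show ?thesis by (simp add: mem_endograph)
qed

lemma H_end_approx:
  assumes u: "usc_fuzzy_set u" and v: "usc_fuzzy_set v" and less: "H_end u v < h"
  obtains y where "dist x y < h" "u x - h < v y"
proof -
  note uD = usc_fuzzy_setD[OF u] and vD = usc_fuzzy_setD[OF v]
  have "(x, u x) \<in> endograph u" using uD by (simp add: mem_endograph)
  then have "infdist (x, u x) (endograph v) < h"
    using infdist_le_H_end[of u v] uD vD less by (meson le_less_trans)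
  then have "(INF q\<in>endograph v. dist (x, u x) q) < h"
    using endograph_nonempty[OF v] by (simp add: infdist_notempty)
  then obtain q where q: "q \<in> endograph v" "dist (x, u x) q < h"
    using endograph_nonempty[OF v] by (subst (asm) cINF_less_iff) (auto intro!: bdd_belowI[of _ 0])
  obtain y s where ys: "q = (y, s)" by (cases q)
  have "dist x y < h" "dist (u x) s < h"
    using q(2) dist_fst_le[of "(x, u x)" q] dist_snd_le[of "(x, u x)" q] by (auto simp: ys)
  moreover have "s \<le> v y" using q(1) ys by (simp add: mem_endograph)
  ultimately show thesis using that by (force simp: dist_real_def)
qed

text \<open>
  The error \<open>h n\<close> is the same for all points \<open>x\<close>.  For star-shaped level sets this uniformity is
  decisive: one level of \<open>v n\<close>, chosen independently of \<open>x\<close>, has to serve all points of a level set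
  of the limit.
\<close>

lemma H_end_recovery:
  fixes v :: "nat \<Rightarrow> 'a::metric_space \<Rightarrow> real"
  assumes u: "usc_fuzzy_set u" and v: "\<And>n. usc_fuzzy_set (v n)"
    and lim: "(\<lambda>n. H_end (v n) u) \<longlonglongrightarrow> 0"
  obtains h Y where "h \<longlonglongrightarrow> 0" "\<And>n. 0 < (h n :: real)" "\<And>x. (\<lambda>n. Y n x) \<longlonglongrightarrow> x"
    "\<And>n x. u x - h n \<le> v n (Y n x)"
proof -
  \<comment> \<open>The added null sequence makes the error exceed the distance, which need not be attained.\<close>
  define h where "h n = H_end (v n) u + inverse (real (Suc n))" for n
  have h: "h \<longlonglongrightarrow> 0"
    using tendsto_add[OF lim LIMSEQ_inverse_real_of_nat] by (simp add: h_def[abs_def])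
  have less: "H_end u (v n) < h n" for n by (simp add: h_def H_end_commute)
  have pos: "0 < h n" for n
    using H_end_nonneg[of u "v n"] less[of n] by linarith
  have "\<exists>y. dist x y < h n \<and> u x - h n < v n y" for n x
    using H_end_approx[OF u v less] by metis
  then have "\<forall>n. \<exists>Y. \<forall>x. dist x (Y x) < h n \<and> u x - h n < v n (Y x)"
    by (intro allI choice)
  then obtain Y where "\<forall>n x. dist x (Y n x) < h n \<and> u x - h n < v n (Y n x)"
    using choice[of "\<lambda>n Y. \<forall>x. dist x (Y x) < h n \<and> u x - h n < v n (Y x)"] by blast
  then have Y: "dist x (Y n x) < h n" "u x - h n < v n (Y n x)" for n x
    by auto
  have "(\<lambda>n. Y n x) \<longlonglongrightarrow> x" for x
    unfolding tendsto_dist_iff[of _ x]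
    by (rule tendsto_sandwich[OF _ _ tendsto_const h])
      (auto simp: dist_commute intro!: always_eventually less_imp_le Y(1))
  then show thesis using that h pos Y(2) less_imp_le by metis
qed

lemma bounded_centre_subsequence:
  fixes c :: "nat \<Rightarrow> 'a::euclidean_space"
  assumes "bounded (\<Union>n. level_set (v n) \<alpha>)" "\<And>n. \<alpha> \<le> v n (c n)" "0 < \<alpha>"
  obtains a s where "strict_mono s" "(\<lambda>n. c (s n)) \<longlonglongrightarrow> a"
proof -
  have "range c \<subseteq> (\<Union>n. level_set (v n) \<alpha>)"
    using assms(2,3) by (auto simp: level_set_def)
  then have "bounded (range c)" using assms(1) bounded_subset by blast
  then show thesis
    using bounded_imp_convergent_subsequence[of c] that by (auto simp: o_def)
qed

lemma normal_limit:
  fixes v :: "nat \<Rightarrow> 'a::euclidean_space \<Rightarrow> real"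
  assumes u: "usc_fuzzy_set u" "bounded (level_set u 0)"
    and v: "\<And>n. v n \<in> normal_bounded_fuzzy_sets" and bd: "bounded (\<Union>n. level_set (v n) 1)"
    and lim: "(\<lambda>n. H_end (v n) u) \<longlonglongrightarrow> 0"
  shows "u \<in> normal_bounded_fuzzy_sets"
proof -
  have usc: "usc_fuzzy_set (v n)" for n
    using v by (simp add: normal_bounded_fuzzy_sets_def)
  obtain c where c: "\<And>n. v n (c n) = 1"
    using v unfolding normal_bounded_fuzzy_sets_def mem_Collect_eq by metis
  obtain a s where s: "strict_mono s" and a: "(\<lambda>n. c (s n)) \<longlonglongrightarrow> a"
    using bd c by (elim bounded_centre_subsequence[where c = c]) auto
  have "1 \<le> u a"
    using LIMSEQ_subseq_LIMSEQ[OF lim s] c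
    by (intro H_end_limit_ge[OF u(1) usc _ a tendsto_const]) (auto simp: o_def)
  then have "u a = 1" using usc_fuzzy_setD(2)[OF u(1), of a] by simp
  then show ?thesis using u by (auto simp: normal_bounded_fuzzy_sets_def)
qed

lemma convex_fuzzy_limit:
  fixes v :: "nat \<Rightarrow> 'a::euclidean_space \<Rightarrow> real"
  assumes u: "u \<in> normal_bounded_fuzzy_sets" and v: "\<And>n. v n \<in> convex_fuzzy_sets"
    and lim: "(\<lambda>n. H_end (v n) u) \<longlonglongrightarrow> 0"
  shows "u \<in> convex_fuzzy_sets"
proof -
  have usc: "usc_fuzzy_set u" "usc_fuzzy_set (v n)" for n
    using u v by (auto simp: convex_fuzzy_sets_def normal_bounded_fuzzy_sets_def)
  obtain h Y where h: "h \<longlonglongrightarrow> 0" and Y: "\<And>x. (\<lambda>n. Y n x) \<longlonglongrightarrow> x"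
    "\<And>n x. u x - h n \<le> v n (Y n x)"
    using H_end_recovery[OF usc lim] by metis
  have "min (u x) (u y) \<le> u (l *\<^sub>R x + (1 - l) *\<^sub>R y)" if l: "l \<in> {0..1}" for x y l
  proof (rule H_end_limit_ge[OF usc lim])
    show "(\<lambda>n. l *\<^sub>R Y n x + (1 - l) *\<^sub>R Y n y) \<longlonglongrightarrow> l *\<^sub>R x + (1 - l) *\<^sub>R y"
      by (intro tendsto_intros Y)
    show "(\<lambda>n. min (u x) (u y) - h n) \<longlonglongrightarrow> min (u x) (u y)"
      using tendsto_diff[OF tendsto_const h] by simp
    have "min (u x) (u y) - h n \<le> v n (l *\<^sub>R Y n x + (1 - l) *\<^sub>R Y n y)" for n
    proof -
      have "min (v n (Y n x)) (v n (Y n y)) \<le> v n (l *\<^sub>R Y n x + (1 - l) *\<^sub>R Y n y)"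
        using v[of n] l by (auto simp: convex_fuzzy_sets_def)
      then show ?thesis using Y(2)[of x n] Y(2)[of y n] by linarith
    qed
    then show "\<forall>\<^sub>F n in sequentially. min (u x) (u y) - h n \<le> v n (l *\<^sub>R Y n x + (1 - l) *\<^sub>R Y n y)"
      by simp
  qed
  then show ?thesis using u by (auto simp: convex_fuzzy_sets_def)
qed

lemma star_fuzzy_limit:
  fixes v :: "nat \<Rightarrow> 'a::euclidean_space \<Rightarrow> real"
  assumes u: "u \<in> normal_bounded_fuzzy_sets" and v: "\<And>n. v n \<in> star_fuzzy_sets"
    and bd: "bounded (\<Union>n. level_set (v n) 1)"
    and lim: "(\<lambda>n. H_end (v n) u) \<longlonglongrightarrow> 0"
  shows "u \<in> star_fuzzy_sets"
proof -
  have usc: "usc_fuzzy_set u" "usc_fuzzy_set (v n)" for n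
    using u v by (auto simp: star_fuzzy_sets_def normal_bounded_fuzzy_sets_def)
  have "\<exists>x. \<forall>y. \<forall>l\<in>{0..1}. v n y \<le> v n (l *\<^sub>R y + (1 - l) *\<^sub>R x)" for n
    using v[of n] by (simp add: star_fuzzy_sets_def)
  then obtain c where c: "\<And>n y l. l \<in> {0..1} \<Longrightarrow> v n y \<le> v n (l *\<^sub>R y + (1 - l) *\<^sub>R c n)"
    by metis
  have "1 \<le> v n (c n)" for n
  proof -
    obtain y where "v n y = 1"
      using v[of n] by (auto simp: star_fuzzy_sets_def normal_bounded_fuzzy_sets_def)
    then show ?thesis using c[of 0 n y] by simp
  qed
  then obtain a s where s: "strict_mono s" and a: "(\<lambda>n. c (s n)) \<longlonglongrightarrow> a"
    using bd by (elim bounded_centre_subsequence[where c = c]) auto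
  have lim': "(\<lambda>n. H_end (v (s n)) u) \<longlonglongrightarrow> 0"
    using LIMSEQ_subseq_LIMSEQ[OF lim s] by (simp add: o_def)
  obtain h Y where h: "h \<longlonglongrightarrow> 0" and Y: "\<And>x. (\<lambda>n. Y n x) \<longlonglongrightarrow> x"
    "\<And>n x. u x - h n \<le> v (s n) (Y n x)"
    using H_end_recovery[OF usc lim'] by metis
  have "u y \<le> u (l *\<^sub>R y + (1 - l) *\<^sub>R a)" if l: "l \<in> {0..1}" for y l
  proof (rule H_end_limit_ge[OF usc lim'])
    show "(\<lambda>n. l *\<^sub>R Y n y + (1 - l) *\<^sub>R c (s n)) \<longlonglongrightarrow> l *\<^sub>R y + (1 - l) *\<^sub>R a"
      by (intro tendsto_intros Y a)
    show "(\<lambda>n. u y - h n) \<longlonglongrightarrow> u y"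
      using tendsto_diff[OF tendsto_const h] by simp
    show "\<forall>\<^sub>F n in sequentially. u y - h n \<le> v (s n) (l *\<^sub>R Y n y + (1 - l) *\<^sub>R c (s n))"
      using order_trans[OF Y(2) c[OF l]] by simp
  qed
  then show ?thesis using u unfolding star_fuzzy_sets_def by blast
qed

text \<open>
  Points of the limit with value at least \<open>\<alpha>\<close> are approximated by points at which \<open>v n\<close> is only
  known to be at least \<open>\<alpha> - h n\<close>.  Therefore the centre for the level \<open>\<alpha>\<close> is obtained from
  centres of the level sets of \<open>v n\<close> at the slightly lower levels \<open>t n\<close>, which tend to \<open>\<alpha>\<close>.
\<close>

lemma level_star_fuzzy_limit:
  fixes v :: "nat \<Rightarrow> 'a::euclidean_space \<Rightarrow> real"
  assumes u: "u \<in> normal_bounded_fuzzy_sets" and v: "\<And>n. v n \<in> level_star_fuzzy_sets"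
    and bd: "\<And>\<alpha>. \<alpha> \<in> {0<..1} \<Longrightarrow> bounded (\<Union>n. level_set (v n) \<alpha>)"
    and lim: "(\<lambda>n. H_end (v n) u) \<longlonglongrightarrow> 0"
  shows "u \<in> level_star_fuzzy_sets"
proof -
  have usc: "usc_fuzzy_set u" "usc_fuzzy_set (v n)" for n
    using u v by (auto simp: level_star_fuzzy_sets_def normal_bounded_fuzzy_sets_def)
  obtain h Y where h: "h \<longlonglongrightarrow> 0" "\<And>n. 0 < h n" and Y: "\<And>x. (\<lambda>n. Y n x) \<longlonglongrightarrow> x"
    "\<And>n x. u x - h n \<le> v n (Y n x)"
    using H_end_recovery[OF usc lim] by metis
  have "\<exists>a\<in>level_set u \<alpha>. \<forall>y\<in>level_set u \<alpha>. closed_segment a y \<subseteq> level_set u \<alpha>"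
    if \<alpha>: "\<alpha> \<in> {0<..1}" for \<alpha>
  proof -
    \<comment> \<open>The lower bound keeps all these centres in one bounded level, that of half the height.\<close>
    define t where "t n = max (\<alpha> / 2) (\<alpha> - h n)" for n
    have t: "t n \<in> {0<..1}" "\<alpha> / 2 \<le> t n" for n
      using \<alpha> h(2)[of n] by (auto simp: t_def)
    have "t \<longlonglongrightarrow> max (\<alpha> / 2) (\<alpha> - 0)"
      unfolding t_def by (intro tendsto_intros h)
    then have t_lim: "t \<longlonglongrightarrow> \<alpha>" using \<alpha> by simp
    have "\<exists>c. t n \<le> v n c \<and> (\<forall>y. t n \<le> v n y \<longrightarrow> (\<forall>z\<in>closed_segment c y. t n \<le> v n z))" for n
      using v[of n] t(1)[of n] by (force simp: level_star_fuzzy_sets_def level_set_def)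
    then obtain c where c: "\<And>n. t n \<le> v n (c n)"
      "\<And>n y z. t n \<le> v n y \<Longrightarrow> z \<in> closed_segment (c n) y \<Longrightarrow> t n \<le> v n z"
      by metis
    have "\<alpha> / 2 \<le> v n (c n)" for n using order_trans[OF t(2) c(1)] .
    moreover have "bounded (\<Union>n. level_set (v n) (\<alpha> / 2))" using \<alpha> by (intro bd) auto
    ultimately obtain a s where s: "strict_mono s" and a: "(\<lambda>n. c (s n)) \<longlonglongrightarrow> a"
      using \<alpha> by (elim bounded_centre_subsequence[where c = c]) auto
    have lims: "(\<lambda>n. H_end (v (s n)) u) \<longlonglongrightarrow> 0" "(\<lambda>n. t (s n)) \<longlonglongrightarrow> \<alpha>"
      "(\<lambda>n. Y (s n) y) \<longlonglongrightarrow> y" for y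
      using LIMSEQ_subseq_LIMSEQ[OF lim s] LIMSEQ_subseq_LIMSEQ[OF t_lim s]
        LIMSEQ_subseq_LIMSEQ[OF Y(1) s] by (simp_all add: o_def)
    have "\<alpha> \<le> u a"
      by (rule H_end_limit_ge[OF usc lims(1) a lims(2)]) (simp add: c(1))
    moreover have "\<alpha> \<le> u z" if y: "\<alpha> \<le> u y" and z: "z \<in> closed_segment a y" for y z
    proof -
      obtain l where l: "0 \<le> l" "l \<le> 1" "z = (1 - l) *\<^sub>R a + l *\<^sub>R y"
        using z by (auto simp: in_segment)
      show ?thesis
      proof (rule H_end_limit_ge[OF usc lims(1) _ lims(2)])
        show "(\<lambda>n. (1 - l) *\<^sub>R c (s n) + l *\<^sub>R Y (s n) y) \<longlonglongrightarrow> z"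
          unfolding l(3) by (intro tendsto_intros a lims)
        have "\<forall>\<^sub>F n in sequentially. h n < \<alpha> / 2"
          using h(1) \<alpha> by (intro order_tendstoD(2)) auto
        then have "\<forall>\<^sub>F n in sequentially.
            t n \<le> v n ((1 - l) *\<^sub>R c n + l *\<^sub>R Y n y)"
        proof eventually_elim
          case (elim n)
          then have "t n \<le> v n (Y n y)"
            using Y(2)[of y n] y by (simp add: t_def)
          moreover have "(1 - l) *\<^sub>R c n + l *\<^sub>R Y n y \<in> closed_segment (c n) (Y n y)"
            using l unfolding in_segment by blast
          ultimately show ?case by (rule c(2))
        qed
        then show "\<forall>\<^sub>F n in sequentially.
            t (s n) \<le> v (s n) ((1 - l) *\<^sub>R c (s n) + l *\<^sub>R Y (s n) y)"
          using s by (rule eventually_subseq[rotated])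
      qed
    qed
    ultimately show ?thesis using \<alpha> by (auto simp: level_set_def)
  qed
  then show ?thesis using u by (simp add: level_star_fuzzy_sets_def)
qed


section \<open>Relatively compact families\<close>

lemma level_set_compact:
  assumes "u \<in> normal_bounded_fuzzy_sets" "\<alpha> \<in> {0<..1}"
  shows "level_set u \<alpha> \<noteq> {}" "compact (level_set u \<alpha>)"
proof -
  have u: "usc_fuzzy_set u" "bounded (level_set u 0)" and "\<exists>x. u x = 1"
    using assms(1) by (auto simp: normal_bounded_fuzzy_sets_def)
  have eq: "level_set u \<alpha> = {x. \<alpha> \<le> u x}" using assms(2) by (simp add: level_set_def)
  obtain x where "u x = 1" using \<open>\<exists>x. u x = 1\<close> by blast
  then have "x \<in> level_set u \<alpha>" using eq assms(2) by simp
  then show "level_set u \<alpha> \<noteq> {}" by blast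
  have "{x. 0 < u x} \<subseteq> level_set u 0" by (simp add: level_set_def closure_subset)
  then have "level_set u \<alpha> \<subseteq> level_set u 0" using eq assms(2) by auto
  moreover have "closed (level_set u \<alpha>)"
    using assms(2) unfolding eq by (intro closed_superlevel closed_endograph u) auto
  ultimately show "compact (level_set u \<alpha>)"
    using u(2) bounded_subset compact_eq_bounded_closed by blast
qed

lemma level_set_convex:
  assumes "u \<in> convex_fuzzy_sets" "\<alpha> \<in> {0<..1}"
  shows "level_set u \<alpha> \<in> compact_convex_sets"
proof -
  have "\<alpha> \<le> u (l *\<^sub>R x + (1 - l) *\<^sub>R y)"
    if "\<alpha> \<le> u x" "\<alpha> \<le> u y" "l \<in> {0..1}" for x y l
  proof -
    have "min (u x) (u y) \<le> u (l *\<^sub>R x + (1 - l) *\<^sub>R y)"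
      using assms(1) that(3) by (simp add: convex_fuzzy_sets_def)
    then show ?thesis using that by linarith
  qed
  then have "\<alpha> \<le> u ((1 - l) *\<^sub>R x + l *\<^sub>R y)"
    if "\<alpha> \<le> u x" "\<alpha> \<le> u y" "0 \<le> l" "l \<le> 1" for x y l
    using that by (simp add: add.commute)
  then have "convex (level_set u \<alpha>)"
    using assms(2) by (simp add: level_set_def convex_alt)
  then show ?thesis
    using assms level_set_compact[of u \<alpha>] by (simp add: compact_convex_sets_def convex_fuzzy_sets_def)
qed

text \<open>
  Moving any point all the way to the centre shows that the centre has the maximal value 1, so it
  belongs to every level set.
\<close>

lemma star_fuzzy_sets_subset: "star_fuzzy_sets \<subseteq> level_star_fuzzy_sets"
proof
  fix u :: "'a \<Rightarrow> real" assume u: "u \<in> star_fuzzy_sets"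
  then have norm: "u \<in> normal_bounded_fuzzy_sets" by (simp add: star_fuzzy_sets_def)
  obtain c where c: "\<And>y l. l \<in> {0..1} \<Longrightarrow> u y \<le> u (l *\<^sub>R y + (1 - l) *\<^sub>R c)"
    using u unfolding star_fuzzy_sets_def by blast
  obtain y where "u y = 1" using norm by (auto simp: normal_bounded_fuzzy_sets_def)
  then have "1 \<le> u c" using c[of 0 y] by simp
  have "closed_segment c y \<subseteq> level_set u \<alpha>" if "y \<in> level_set u \<alpha>" "\<alpha> \<in> {0<..1}" for y \<alpha>
    using that order_trans[OF _ c] by (force simp: level_set_def in_segment add.commute)
  then show "u \<in> level_star_fuzzy_sets"
    using norm \<open>1 \<le> u c\<close> by (force simp: level_star_fuzzy_sets_def level_set_def)
qed

lemma level_set_starlike: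
  assumes "u \<in> level_star_fuzzy_sets" "\<alpha> \<in> {0<..1}"
  shows "level_set u \<alpha> \<in> compact_starlike_sets"
  using assms level_set_compact[of u \<alpha>]
  by (simp add: compact_starlike_sets_def level_star_fuzzy_sets_def starlike_def)

text \<open>
  A point where \<open>v n\<close> is at least \<open>\<alpha>\<close> has, once \<open>v n\<close> is closer than \<open>\<alpha>\<close> to the limit, a point of
  positive value of the limit within distance \<open>\<alpha>\<close>.  The support of the limit is bounded.
\<close>

lemma bounded_levels_if_subsequences_converge:
  fixes U :: "('a::euclidean_space \<Rightarrow> real) set"
  assumes usc: "\<And>u. u \<in> U \<Longrightarrow> usc_fuzzy_set u" and "0 < \<alpha>"
    and sub: "\<And>v :: nat \<Rightarrow> 'a \<Rightarrow> real. range v \<subseteq> U \<Longrightarrow>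
      \<exists>l\<in>normal_bounded_fuzzy_sets. \<exists>s. strict_mono s \<and> (\<lambda>n. H_end (v (s n)) l) \<longlonglongrightarrow> 0"
  shows "bounded (\<Union>u\<in>U. level_set u \<alpha>)"
proof (rule ccontr)
  assume unb: "\<not> bounded (\<Union>u\<in>U. level_set u \<alpha>)"
  have "\<exists>u x. u \<in> U \<and> \<alpha> \<le> u x \<and> real n < norm x" for n
  proof -
    have "\<exists>x\<in>(\<Union>u\<in>U. level_set u \<alpha>). \<not> norm x \<le> real n"
      using unb unfolding bounded_iff by blast
    then show ?thesis using \<open>0 < \<alpha>\<close> by (auto simp: level_set_def not_le)
  qed
  then obtain v x where v: "\<And>n. v n \<in> U" "\<And>n. \<alpha> \<le> v n (x n)" "\<And>n. real n < norm (x n)"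
    by metis
  then obtain l s where l: "l \<in> normal_bounded_fuzzy_sets" and s: "strict_mono s"
    and lim: "(\<lambda>n. H_end (v (s n)) l) \<longlonglongrightarrow> 0"
    using sub[of v] by blast
  have "usc_fuzzy_set l" "bounded (level_set l 0)"
    using l by (auto simp: normal_bounded_fuzzy_sets_def)
  then obtain b where b: "\<And>y. y \<in> level_set l 0 \<Longrightarrow> norm y \<le> b"
    unfolding bounded_iff by blast
  have "\<forall>\<^sub>F n in sequentially. H_end (v (s n)) l < \<alpha>"
    using lim \<open>0 < \<alpha>\<close> by (rule order_tendstoD(2))
  moreover have "\<forall>\<^sub>F n in sequentially. b + \<alpha> < real n"
    using filterlim_real_sequentially by (simp add: filterlim_at_top_dense)
  ultimately have "\<forall>\<^sub>F n in sequentially. False"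
  proof eventually_elim
    case (elim n)
    obtain y where y: "dist (x (s n)) y < \<alpha>" "v (s n) (x (s n)) - \<alpha> < l y"
      using H_end_approx[OF usc[OF v(1)] \<open>usc_fuzzy_set l\<close> elim(1)] by blast
    have "0 < l y" using y(2) v(2)[of "s n"] by linarith
    then have "y \<in> level_set l 0"
      using closure_subset[of "{x. 0 < l x}"] by (auto simp: level_set_def)
    then have "norm (x (s n)) < b + \<alpha>"
      using b[of y] y(1) norm_triangle_sub[of "x (s n)" y] by (simp add: dist_norm)
    moreover have "real n \<le> real (s n)" using seq_suble[OF s, of n] by simp
    ultimately show ?case using v(3)[of "s n"] elim(2) by linarith
  qed
  then show False by simp
qed

lemma ball_excess_le_H_end:
  fixes u v :: "'a::real_normed_vector \<Rightarrow> real"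
  assumes "usc_fuzzy_set u" "usc_fuzzy_set v" "{x. 0 < u x} \<subseteq> cball 0 r"
  shows "ball_excess r v \<le> H_end v u"
proof -
  note uD = usc_fuzzy_setD[OF assms(1)] and vD = usc_fuzzy_setD[OF assms(2)]
  let ?B = "endograph (indicat_real (cball (0::'a) r))"
  have "endograph u \<subseteq> ?B"
    using assms(3) by (force simp: endograph_indicator mem_endograph)
  then have "infdist p ?B \<le> infdist p (endograph u)" for p
    using endograph_nonempty[OF assms(1)] by (intro infdist_mono)
  moreover have "infdist p (endograph u) \<le> H_end v u" if "p \<in> endograph v" for p
    using that uD vD by (intro infdist_le_H_end)
  ultimately have "infdist p ?B \<le> H_end v u" if "p \<in> endograph v" for p
    using that order_trans by blast
  then show ?thesis
    using vD by (subst ball_excess_le_iff) (auto simp: H_end_nonneg)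
qed

text \<open>
  The three families are treated at once up to the last step: all consist of normal fuzzy sets with
  bounded support, and each has its own lemma for passing to the limit.
\<close>

theorem theorem9p21:
  fixes X U :: "(real ^ 'm \<Rightarrow> real) set" and K :: "(real ^ 'm) set set"
  assumes "(X, K) \<in> {(level_star_fuzzy_sets, compact_starlike_sets),
                     (star_fuzzy_sets, compact_starlike_sets),
                     (convex_fuzzy_sets, compact_convex_sets)}"
    and "U \<subseteq> X"
  shows "relatively_compactin (Metric_space.mtopology X H_end) U \<longleftrightarrow>
    (\<forall>\<alpha>\<in>{0<..1}. Metric_space.mbounded K hausdorff_dist {level_set u \<alpha> | u. u \<in> U}) \<and>
    (\<forall>u :: nat \<Rightarrow> real ^ 'm \<Rightarrow> real. range u \<subseteq> U \<longrightarrow>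
      (\<exists>r>0. \<exists>s :: nat \<Rightarrow> nat. strict_mono s \<and>
        (\<lambda>n. ball_excess r (u (s n))) \<longlonglongrightarrow> 0))"
proof -
  have X: "Metric_space X H_end" "X \<subseteq> normal_bounded_fuzzy_sets"
    using assms(1) Metric_space_convex_fuzzy_sets Metric_space_star_fuzzy_sets
      Metric_space_level_star_fuzzy_sets
    by (auto simp: convex_fuzzy_sets_def star_fuzzy_sets_def level_star_fuzzy_sets_def)
  have usc: "usc_fuzzy_set u" if "u \<in> X" for u
    using that X(2) by (auto simp: normal_bounded_fuzzy_sets_def)
  have K: "Metric_space K hausdorff_dist" "{0} \<in> K" "\<And>A. A \<in> K \<Longrightarrow> A \<noteq> {} \<and> compact A"
    using assms(1) Metric_space_compact_convex_sets Metric_space_compact_starlike_sets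
    by (auto simp: compact_convex_sets_def compact_starlike_sets_def starlike_def)
  have levels: "level_set u \<alpha> \<in> K" if "u \<in> X" "\<alpha> \<in> {0<..1}" for u \<alpha>
    using assms(1) that level_set_convex level_set_starlike star_fuzzy_sets_subset by blast
  have bdd: "Metric_space.mbounded K hausdorff_dist {level_set u \<alpha> | u. u \<in> U} \<longleftrightarrow>
      bounded (\<Union>u\<in>U. level_set u \<alpha>)" if "\<alpha> \<in> {0<..1}" for \<alpha>
  proof -
    have "Metric_space.mbounded K hausdorff_dist {level_set u \<alpha> | u. u \<in> U} \<longleftrightarrow>
        bounded (\<Union>{level_set u \<alpha> | u. u \<in> U})"
      using levels[OF _ that] assms(2) K by (intro mbounded_hausdorff_iff) auto
    also have "\<Union>{level_set u \<alpha> | u. u \<in> U} = (\<Union>u\<in>U. level_set u \<alpha>)" by blast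
    finally show ?thesis .
  qed
  let ?conv = "\<lambda>v :: nat \<Rightarrow> real ^ 'm \<Rightarrow> real.
    \<exists>l\<in>X. \<exists>s. strict_mono s \<and> (\<lambda>n. H_end (v (s n)) l) \<longlonglongrightarrow> 0"
  let ?excess = "\<lambda>v :: nat \<Rightarrow> real ^ 'm \<Rightarrow> real.
    \<exists>r>0. \<exists>s :: nat \<Rightarrow> nat. strict_mono s \<and> (\<lambda>n. ball_excess r (v (s n))) \<longlonglongrightarrow> 0"
  have "relatively_compactin (Metric_space.mtopology X H_end) U \<longleftrightarrow>
      (\<forall>v. range v \<subseteq> U \<longrightarrow> ?conv v)"
    unfolding relatively_compactin_def
    by (rule Metric_space.compactin_closure_of_sequentially[OF X(1) assms(2)])
  also have "\<dots> \<longleftrightarrow> (\<forall>\<alpha>\<in>{0<..1}. bounded (\<Union>u\<in>U. level_set u \<alpha>)) \<and>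
      (\<forall>v. range v \<subseteq> U \<longrightarrow> ?excess v)"
  proof (intro iffI conjI allI ballI impI)
    fix \<alpha> :: real
    assume R: "\<forall>v. range v \<subseteq> U \<longrightarrow> ?conv v" and "\<alpha> \<in> {0<..1}"
    show "bounded (\<Union>u\<in>U. level_set u \<alpha>)"
    proof (rule bounded_levels_if_subsequences_converge)
      fix v :: "nat \<Rightarrow> real ^ 'm \<Rightarrow> real" assume "range v \<subseteq> U"
      then show "\<exists>l\<in>normal_bounded_fuzzy_sets. \<exists>s. strict_mono s \<and> (\<lambda>n. H_end (v (s n)) l) \<longlonglongrightarrow> 0"
        using R X(2) by blast
    qed (use usc assms(2) \<open>\<alpha> \<in> {0<..1}\<close> in auto)
  next
    fix v :: "nat \<Rightarrow> real ^ 'm \<Rightarrow> real"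
    assume "\<forall>v. range v \<subseteq> U \<longrightarrow> ?conv v" and v: "range v \<subseteq> U"
    then obtain l s where l: "l \<in> X" and s: "strict_mono s"
      and lim: "(\<lambda>n. H_end (v (s n)) l) \<longlonglongrightarrow> 0" by blast
    have "bounded (level_set l 0)" using l X(2) by (auto simp: normal_bounded_fuzzy_sets_def)
    then obtain r where r: "0 < r" "\<And>x. x \<in> level_set l 0 \<Longrightarrow> norm x \<le> r"
      by (auto simp: bounded_pos)
    have "{x. 0 < l x} \<subseteq> level_set l 0" by (simp add: level_set_def closure_subset)
    then have supp: "{x. 0 < l x} \<subseteq> cball 0 r" using r(2) by auto
    have "usc_fuzzy_set (v n)" for n using v assms(2) usc by blast
    then have "ball_excess r (v (s n)) \<le> H_end (v (s n)) l" for n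
      using usc[OF l] supp by (intro ball_excess_le_H_end)
    then have "(\<lambda>n. ball_excess r (v (s n))) \<longlonglongrightarrow> 0"
      by (intro tendsto_sandwich[OF _ _ tendsto_const lim])
        (auto simp: ball_excess_def H_end_nonneg)
    then show "?excess v" using r(1) s by blast
  next
    fix v :: "nat \<Rightarrow> real ^ 'm \<Rightarrow> real"
    assume R: "(\<forall>\<alpha>\<in>{0<..1}. bounded (\<Union>u\<in>U. level_set u \<alpha>)) \<and>
      (\<forall>v. range v \<subseteq> U \<longrightarrow> ?excess v)" and v: "range v \<subseteq> U"
    then obtain r s where s: "strict_mono s" and ex: "(\<lambda>n. ball_excess r (v (s n))) \<longlonglongrightarrow> 0"
      by blast
    have vX: "v n \<in> X" for n using v assms(2) by blast
    obtain u k where u: "usc_fuzzy_set u" "{x. 0 < u x} \<subseteq> cball 0 r" and k: "strict_mono k"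
      and lim: "(\<lambda>n. H_end (v (s (k n))) u) \<longlonglongrightarrow> 0"
      using usc_fuzzy_setD(1)[OF usc[OF vX]]
      by (rule H_end_convergent_subsequence[OF _ ex])
    have "level_set u 0 \<subseteq> cball 0 r"
      using u(2) by (simp add: level_set_def closure_minimal)
    then have u0: "bounded (level_set u 0)" using bounded_subset bounded_cball by blast
    define w where "w n = v (s (k n))" for n
    have wX: "w n \<in> X" for n using vX by (simp add: w_def)
    have lim': "(\<lambda>n. H_end (w n) u) \<longlonglongrightarrow> 0" using lim by (simp add: w_def)
    have bd: "bounded (\<Union>n. level_set (w n) \<alpha>)" if "\<alpha> \<in> {0<..1}" for \<alpha>
    proof (rule bounded_subset)
      show "bounded (\<Union>u\<in>U. level_set u \<alpha>)" using R that by blast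
      show "(\<Union>n. level_set (w n) \<alpha>) \<subseteq> (\<Union>u\<in>U. level_set u \<alpha>)"
        using v by (auto simp: w_def)
    qed
    have "w n \<in> normal_bounded_fuzzy_sets" for n using wX X(2) by blast
    then have norm: "u \<in> normal_bounded_fuzzy_sets"
      using bd[of 1] by (intro normal_limit[OF u(1) u0 _ _ lim']) auto
    have "u \<in> X"
      using assms(1) wX bd[of 1] level_star_fuzzy_limit[OF norm _ bd lim']
        star_fuzzy_limit[OF norm _ _ lim'] convex_fuzzy_limit[OF norm _ lim']
      by auto
    moreover have "strict_mono (s \<circ> k)" using s k by (rule strict_mono_o)
    ultimately show "?conv v"
      using lim by (intro bexI[of _ u] exI[of _ "s \<circ> k"]) auto
  qed
  finally show ?thesis using bdd by simp
qed

end
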